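(* Let $n\geq 2$ and $k>2$ be integers. Then: (i) for an integer $r$ with $0\leq r\leq (k-1)n$, the digraph $S_k^{r,r}(n-1)$ is Eulerian if and only if $r\in\{0,1,(k-1)n-1,(k-1)n\}$; (ii) $S_k^{r,r+1}(n-1)$ is Eulerian for every integer $r$ with $0\leq r<(k-1)n$.
   Context: A $k$-ary $n$-tuple is an element of $\mathbb{Z}_k^n$, with entries identified with the integers $0,1,\dots,k-1$. The de Bruijn digraph $B_k(n-1)$ has vertex set $\mathbb{Z}_k^{n-1}$, and its edges are identified with the $k$-ary $n$-tuples: the $n$-tuple $(x_0,\dots,x_{n-1})$ is the edge from vertex $(x_0,\dots,x_{n-2})$ to vertex $(x_1,\dots,x_{n-1})$ (loops allowed). A subgraph "consisting of" a set of edges has exactly those edges, and its vertices are the vertices incident with at least one of them. A digraph is Eulerian if it is strongly connected (there is a directed path between any ordered pair of its vertices) and balanced (every vertex has in-degree equal to out-degree). The digit sum of a $k$-ary $n$-tuple $\mathbf{a}=(a_0,\dots,a_{n-1})$ is $w_s(\mathbf{a})=\sum_{i=0}^{n-1}a_i$, computed in $\mathbb{Z}$ with each $a_i$ an integer in $[0,k-1]$. For integers $0\leq r\leq s\leq n(k-1)$, $S_k^{r,s}(n-1)$ is the subgraph of $B_k(n-1)$ consisting of the edges corresponding to $n$-tuples $\mathbf{a}$ with $r\leq w_s(\mathbf{a})\leq s$. *)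

theory Defs
  imports "Graph_Theory.Digraph_Component"
begin

definition tuples :: "nat \<Rightarrow> nat \<Rightarrow> nat list set" where
  "tuples k n = {a. length a = n \<and> set a \<subseteq> {..<k}}"

definition de_bruijn :: "nat \<Rightarrow> nat \<Rightarrow> (nat list, nat list) pre_digraph" where
  "de_bruijn k m = \<lparr>verts = tuples k m, arcs = tuples k (m + 1), tail = butlast, head = tl\<rparr>"

text \<open>Only meaningful when \<open>A\<close> is a subset of the arcs of \<open>G\<close>; vertices of \<open>G\<close> that are
  incident with no arc in \<open>A\<close> are dropped.\<close>

definition arc_subgraph :: "('a, 'b) pre_digraph \<Rightarrow> 'b set \<Rightarrow> ('a, 'b) pre_digraph" where
  "arc_subgraph G A = G\<lparr>verts := tail G ` A \<union> head G ` A, arcs := A\<rparr>"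

definition balanced :: "('a, 'b) pre_digraph \<Rightarrow> bool" where
  "balanced G \<longleftrightarrow> (\<forall>v \<in> verts G. in_degree G v = out_degree G v)"

text \<open>The constant \<^const>\<open>strongly_connected\<close> also demands a nonempty vertex set.\<close>

definition eulerian :: "('a, 'b) pre_digraph \<Rightarrow> bool" where
  "eulerian G \<longleftrightarrow> strongly_connected G \<and> balanced G"

definition digit_sum :: "nat list \<Rightarrow> nat" where
  "digit_sum a = sum_list a"

text \<open>The argument \<open>m\<close> is the length of the vertices, as for \<^const>\<open>de_bruijn\<close>, so the arcs
  are tuples of length \<open>m + 1\<close>.\<close>

definition digit_sum_digraph ::
    "nat \<Rightarrow> nat \<Rightarrow> nat \<Rightarrow> nat \<Rightarrow> (nat list, nat list) pre_digraph" where
  "digit_sum_digraph k r s m =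
    arc_subgraph (de_bruijn k m) {a \<in> arcs (de_bruijn k m). r \<le> digit_sum a \<and> digit_sum a \<le> s}"

lemma fin_digraph_de_bruijn: "fin_digraph (de_bruijn k m)"
proof
  show "finite (verts (de_bruijn k m))" "finite (arcs (de_bruijn k m))"
    using finite_lists_length_eq[of "{..<k}"]
    by (simp_all add: de_bruijn_def tuples_def conj_commute)
next
  fix e assume "e \<in> arcs (de_bruijn k m)"
  then have e: "length e = m + 1" "set e \<subseteq> {..<k}"
    by (auto simp: de_bruijn_def tuples_def)
  have "set (butlast e) \<subseteq> set e" "set (tl e) \<subseteq> set e"
    by (auto dest: in_set_butlastD) (cases e; simp)
  with e show "tail (de_bruijn k m) e \<in> verts (de_bruijn k m)"
    "head (de_bruijn k m) e \<in> verts (de_bruijn k m)"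
    by (auto simp: de_bruijn_def tuples_def)
qed

lemma subgraph_digit_sum_digraph: "subgraph (digit_sum_digraph k r s m) (de_bruijn k m)"
proof -
  interpret fin_digraph "de_bruijn k m" by (rule fin_digraph_de_bruijn)
  have "wf_digraph (digit_sum_digraph k r s m)"
    by unfold_locales (auto simp: digit_sum_digraph_def arc_subgraph_def)
  then show ?thesis
    using wf_digraph
    by (auto simp: subgraph_def compatible_def digit_sum_digraph_def arc_subgraph_def)
qed

end

theory Submission
  imports Defs "HOL-Library.Multiset"
begin

text \<open>All rotations of an arc are arcs of the same weight, and the tail of the rotation of an arc is
  its head; so every arc lies on a closed walk of rotations. Hence these digraphs are balanced,
  reachability is symmetric, and altering a single digit of an arc does not change the strong
  component, since the digit can be rotated to the end, where it is forgotten by the tail. With two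
  consecutive weights allowed, unit changes connect all tuples. With a single weight \<open>r\<close>, a vertex
  determines the missing digit of its incident arcs, so the multiset of digits is constant along
  walks; for \<open>r\<close> away from the extremes two multisets occur, and for the four extreme values all
  tuples of weight \<open>r\<close> are rotations of each other.\<close>

section \<open>Arcs, balance and tuples of prescribed weight\<close>

lemma arcs_digit_sum_digraph:
  "arcs (digit_sum_digraph k r s m) = {a \<in> tuples k (m + 1). r \<le> sum_list a \<and> sum_list a \<le> s}"
  and tail_digit_sum_digraph: "tail (digit_sum_digraph k r s m) = butlast"
  and head_digit_sum_digraph: "head (digit_sum_digraph k r s m) = tl"
  by (auto simp: digit_sum_digraph_def arc_subgraph_def de_bruijn_def digit_sum_def)

lemmas digit_sum_digraph_simps =
  arcs_digit_sum_digraph tail_digit_sum_digraph head_digit_sum_digraph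

lemma sum_list_rotate: "sum_list (rotate i a) = sum_list (a :: 'a::comm_monoid_add list)"
proof (induction i)
  case (Suc i)
  then show ?case by (cases "rotate i a") (auto simp: add.commute)
qed simp

text \<open>The tuples \<open>x # v\<close> and \<open>v @ [x]\<close> have the same digits, so one
  is an arc exactly when the other is. The set \<open>X\<close> of admissible digits therefore
  indexes both the in-arcs and the out-arcs of \<open>v\<close>.\<close>

lemma balanced_digit_sum_digraph: "balanced (digit_sum_digraph k r s m)"
  unfolding balanced_def
proof
  fix v
  define X where "X = {x. x # v \<in> arcs (digit_sum_digraph k r s m)}"
  have "in_arcs (digit_sum_digraph k r s m) v = (\<lambda>x. x # v) ` X"
    unfolding X_def in_arcs_def digit_sum_digraph_simps image_def
    by (auto simp: tuples_def length_Suc_conv)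
  moreover have "out_arcs (digit_sum_digraph k r s m) v = (\<lambda>x. v @ [x]) ` X"
  proof (intro equalityI subsetI)
    fix e assume "e \<in> out_arcs (digit_sum_digraph k r s m) v"
    then have "v = butlast e" "e \<noteq> []" and e: "e \<in> arcs (digit_sum_digraph k r s m)"
      by (auto simp: out_arcs_def digit_sum_digraph_simps tuples_def)
    then have "e = v @ [last e]" by simp
    then obtain x where x: "e = v @ [x]" by blast
    with e have "x \<in> X"
      by (auto simp: X_def arcs_digit_sum_digraph tuples_def add.commute)
    with x show "e \<in> (\<lambda>x. v @ [x]) ` X" by blast
  qed (auto simp: X_def out_arcs_def digit_sum_digraph_simps tuples_def add.commute)
  ultimately show
    "in_degree (digit_sum_digraph k r s m) v = out_degree (digit_sum_digraph k r s m) v"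
    by (simp add: in_degree_def out_degree_def card_image inj_on_def)
qed

text \<open>Greedy filling: the first digit takes as much of \<open>r\<close> as one position can
  hold, and what is left fits into the remaining positions.\<close>

lemma tuples_of_sum_nonempty:
  assumes "r \<le> (k - 1) * n" and "k > 0"
  shows "\<exists>a \<in> tuples k n. sum_list a = r"
  using assms(1)
proof (induction n arbitrary: r)
  case 0
  then show ?case by (auto simp: tuples_def)
next
  case (Suc n)
  define x where "x = min r (k - 1)"
  have "r - x \<le> (k - 1) * n"
    using Suc.prems by (auto simp: x_def)
  with Suc.IH obtain a where "a \<in> tuples k n" "sum_list a = r - x"
    by blast
  then have "x # a \<in> tuples k (Suc n)" "sum_list (x # a) = r"
    using \<open>k > 0\<close> by (auto simp: tuples_def x_def)
  then show ?case by blast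
qed

section \<open>Reachability along rotations\<close>

lemma rotate_in_arcs:
  "a \<in> arcs (digit_sum_digraph k r s m) \<Longrightarrow> rotate i a \<in> arcs (digit_sum_digraph k r s m)"
  by (simp add: arcs_digit_sum_digraph sum_list_rotate tuples_def)

lemma wf_digraph_digit_sum_digraph: "wf_digraph (digit_sum_digraph k r s m)"
  using subgraph_digit_sum_digraph by (auto simp: subgraph_def)

text \<open>The head of an arc is the tail of its next rotation, so \<open>i\<close> successive
  rotations form a walk.\<close>

lemma reachable_rotate:
  assumes "a \<in> arcs (digit_sum_digraph k r s m)"
  shows "butlast a \<rightarrow>\<^sup>*\<^bsub>digit_sum_digraph k r s m\<^esub> butlast (rotate i a)"
proof (induction i)
  interpret wf_digraph "digit_sum_digraph k r s m"
    by (rule wf_digraph_digit_sum_digraph)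
  {
    case 0
    then show ?case
      using tail_in_verts[OF assms] by (simp add: tail_digit_sum_digraph)
  next
    case (Suc i)
    let ?b = "rotate i a"
    have b: "?b \<in> arcs (digit_sum_digraph k r s m)"
      by (rule rotate_in_arcs) (rule assms)
    then have "butlast ?b \<rightarrow>\<^bsub>digit_sum_digraph k r s m\<^esub> tl ?b"
      by (metis dominatesI arc_to_ends_def tail_digit_sum_digraph head_digit_sum_digraph)
    moreover have "tl ?b = butlast (rotate (Suc i) a)"
      using b by (cases ?b) (auto simp: arcs_digit_sum_digraph tuples_def)
    ultimately show ?case
      using Suc.IH by (metis reachable_adjI reachable_trans)
  }
qed

lemma reachable_rotate_back:
  assumes "a \<in> arcs (digit_sum_digraph k r s m)"
  shows "butlast (rotate i a) \<rightarrow>\<^sup>*\<^bsub>digit_sum_digraph k r s m\<^esub> butlast a"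
proof -
  \<comment> \<open>Going back means rotating on: this many further rotations complete a whole
    number of turns.\<close>
  have "rotate (length a - i mod length a) (rotate i a) = a"
  proof (cases "a = []")
    case False
    then have "length a - i mod length a + i = length a + (i - i mod length a)"
      by (simp add: less_imp_le)
    also have "\<dots> mod length a = 0"
      by (simp add: minus_mod_eq_mult_div)
    finally have "(length a - i mod length a + i) mod length a = 0" .
    then show ?thesis
      by (simp add: rotate_rotate rotate_id)
  qed simp
  then show ?thesis
    using reachable_rotate[OF rotate_in_arcs[OF assms, of i]] by metis
qed

text \<open>The walk follows the rotations of \<open>a\<close> until position \<open>i\<close> is
  last. There \<open>butlast\<close> hides that digit, so the vertex is also a tail of a rotation of
  \<open>a[i := x]\<close>, whose rotations are then followed back.\<close>

lemma reachable_change_digit: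
  assumes a: "a \<in> arcs (digit_sum_digraph k r s m)"
    and b: "a[i := x] \<in> arcs (digit_sum_digraph k r s m)"
  shows "butlast a \<rightarrow>\<^sup>*\<^bsub>digit_sum_digraph k r s m\<^esub> butlast (a[i := x])"
proof (cases "i < length a")
  case True
  interpret wf_digraph "digit_sum_digraph k r s m"
    by (rule wf_digraph_digit_sum_digraph)
  have rot: "butlast (rotate (Suc i) (take i a @ y # drop (Suc i) a)) = drop (Suc i) a @ take i a"
    for y
  proof -
    have "rotate (Suc i) (take i a @ y # drop (Suc i) a)
        = rotate (length (take i a @ [y])) ((take i a @ [y]) @ drop (Suc i) a)"
      using True by simp
    also have "\<dots> = (drop (Suc i) a @ take i a) @ [y]"
      by (subst rotate_append) simp
    finally show ?thesis by (simp only: butlast_snoc)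
  qed
  have "butlast (rotate (Suc i) a) = butlast (rotate (Suc i) (a[i := x]))"
    using rot True by (metis id_take_nth_drop upd_conv_take_nth_drop)
  then show ?thesis
    using reachable_rotate[OF a, of "Suc i"] reachable_rotate_back[OF b, of "Suc i"]
    by (metis reachable_trans)
next
  case False
  with reachable_rotate[OF a, of 0] show ?thesis by (simp add: list_update_beyond)
qed

text \<open>Every head is also the tail of a rotated arc, so reachability needs to be checked
  between tails of arcs only.\<close>

lemma eulerian_digit_sum_digraphI:
  assumes ne: "arcs (digit_sum_digraph k r s m) \<noteq> {}"
    and reach: "\<And>a b. a \<in> arcs (digit_sum_digraph k r s m) \<Longrightarrow>
      b \<in> arcs (digit_sum_digraph k r s m) \<Longrightarrow>
      butlast a \<rightarrow>\<^sup>*\<^bsub>digit_sum_digraph k r s m\<^esub> butlast b"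
  shows "eulerian (digit_sum_digraph k r s m)"
proof -
  interpret wf_digraph "digit_sum_digraph k r s m"
    by (rule wf_digraph_digit_sum_digraph)
  have tl_rotate: "tl a = butlast (rotate 1 a)" if "a \<in> arcs (digit_sum_digraph k r s m)" for a
    using that by (cases a) (auto simp: arcs_digit_sum_digraph tuples_def)
  have "verts (digit_sum_digraph k r s m)
      = butlast ` arcs (digit_sum_digraph k r s m) \<union> tl ` arcs (digit_sum_digraph k r s m)"
    by (simp add: digit_sum_digraph_def arc_subgraph_def de_bruijn_def)
  also have "\<dots> = butlast ` arcs (digit_sum_digraph k r s m)"
    using tl_rotate rotate_in_arcs by fastforce
  finally have verts: "verts (digit_sum_digraph k r s m) = butlast ` arcs (digit_sum_digraph k r s m)" .
  show ?thesis
    unfolding eulerian_def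
  proof
    show "strongly_connected (digit_sum_digraph k r s m)"
      unfolding strongly_connected_def using ne reach by (auto simp: verts)
  qed (rule balanced_digit_sum_digraph)
qed

section \<open>Two consecutive weights\<close>

lemma ex_nth_less_of_sum_list_eq:
  fixes a b :: "nat list"
  assumes "length a = length b" "sum_list a = sum_list b" "a \<noteq> b"
  shows "\<exists>i < length a. a ! i < b ! i"
proof (rule ccontr)
  assume "\<not> ?thesis"
  then have le: "\<forall>i < length a. b ! i \<le> a ! i" by auto
  obtain j where "j < length a" "a ! j \<noteq> b ! j"
    using assms(1,3) nth_equalityI by blast
  with le have "(\<Sum>i<length a. b ! i) < (\<Sum>i<length a. a ! i)"
    by (intro sum_strict_mono_ex1) (auto intro!: bexI[of _ j] simp: order_less_le)
  with assms(1,2) show False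
    by (simp add: sum_list_sum_nth atLeast0LessThan)
qed

text \<open>Moving one unit from a position where \<open>a\<close> exceeds \<open>b\<close> to one
  where it falls short brings \<open>a\<close> closer to \<open>b\<close>. Raising first and
  lowering second passes through weight \<open>r + 1\<close>, which is allowed.\<close>

lemma reachable_consecutive_sums:
  assumes a: "a \<in> tuples k (m + 1)" "sum_list a = r"
    and b: "b \<in> tuples k (m + 1)" "sum_list b = r"
  shows "butlast a \<rightarrow>\<^sup>*\<^bsub>digit_sum_digraph k r (r + 1) m\<^esub> butlast b"
  using a
\<comment> \<open>Subtraction on \<open>nat\<close> truncates at 0, so the measure counts only the
  excess of \<open>a\<close> over \<open>b\<close>.\<close>
proof (induction "\<Sum>i<m + 1. a ! i - b ! i" arbitrary: a rule: less_induct)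
  case less
  interpret wf_digraph "digit_sum_digraph k r (r + 1) m"
    by (rule wf_digraph_digit_sum_digraph)
  have arcI: "c \<in> arcs (digit_sum_digraph k r (r + 1) m)"
    if "c \<in> tuples k (m + 1)" "sum_list c = r \<or> sum_list c = r + 1" for c
    using that by (auto simp: arcs_digit_sum_digraph)
  have len: "length a = m + 1" "length b = m + 1"
    using less.prems b by (auto simp: tuples_def)
  have update: "c[i := x] \<in> tuples k (m + 1)"
    if "c \<in> tuples k (m + 1)" "x < k" for c i x
    using that set_update_subset_insert[of c i x] by (auto simp: tuples_def)
  have digit: "c ! i < k" if "c \<in> tuples k (m + 1)" "i < m + 1" for c i
    using that subsetD[of "set c" "{..<k}" "c ! i"] by (auto simp: tuples_def)
  show ?case
  proof (cases "a = b")
    case True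
    with reachable_rotate[OF arcI[OF less.prems(1)], of 0] less.prems(2) show ?thesis
      by simp
  next
    case False
    obtain i where i: "i < m + 1" "a ! i < b ! i"
      using ex_nth_less_of_sum_list_eq[of a b] False len less.prems(2) b(2) by auto
    obtain j where j: "j < m + 1" "b ! j < a ! j"
      using ex_nth_less_of_sum_list_eq[of b a] False len less.prems(2) b(2) by auto
    define c where "c = a[i := a ! i + 1]"
    define d where "d = c[j := a ! j - 1]"
    have "i \<noteq> j" using i j by auto
    have c: "c \<in> tuples k (m + 1)"
      unfolding c_def using i digit[OF b(1) i(1)] less.prems(1) by (intro update) auto
    have csum: "sum_list c = r + 1"
      unfolding c_def using i len less.prems(2) by (simp add: sum_list_update)
    have d: "d \<in> tuples k (m + 1)"
      unfolding d_def using digit[OF less.prems(1) j(1)] c by (intro update) auto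
    have cj: "c ! j = a ! j"
      using \<open>i \<noteq> j\<close> by (simp add: c_def)
    have "length c = m + 1" by (simp add: c_def len)
    with cj j csum have dsum: "sum_list d = r"
      by (simp add: d_def sum_list_update)
    \<comment> \<open>Raising position \<open>i\<close> creates no excess, because
      \<open>a ! i + 1 \<le> b ! i\<close>; lowering position \<open>j\<close> removes one unit of
      it.\<close>
    have dnth: "d ! l - b ! l \<le> a ! l - b ! l" if "l < m + 1" for l
      using that i j len by (auto simp: d_def c_def nth_list_update)
    have "d ! j - b ! j < a ! j - b ! j"
      using j len by (auto simp: d_def c_def nth_list_update)
    with dnth j have "(\<Sum>l<m + 1. d ! l - b ! l) < (\<Sum>l<m + 1. a ! l - b ! l)"
      by (intro sum_strict_mono_ex1) auto
    then have "butlast d \<rightarrow>\<^sup>*\<^bsub>digit_sum_digraph k r (r + 1) m\<^esub> butlast b"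
      using d dsum by (rule less.hyps)
    moreover have "butlast a \<rightarrow>\<^sup>*\<^bsub>digit_sum_digraph k r (r + 1) m\<^esub> butlast c"
      using c csum less.prems unfolding c_def by (intro reachable_change_digit arcI) auto
    moreover have "butlast c \<rightarrow>\<^sup>*\<^bsub>digit_sum_digraph k r (r + 1) m\<^esub> butlast d"
      using c csum d dsum unfolding d_def by (intro reachable_change_digit arcI) auto
    ultimately show ?thesis
      by (metis reachable_trans)
  qed
qed

lemma eulerian_consecutive_sums:
  assumes "r \<le> (k - 1) * (m + 1)" and "k > 0"
  shows "eulerian (digit_sum_digraph k r (r + 1) m)"
proof (rule eulerian_digit_sum_digraphI)
  interpret wf_digraph "digit_sum_digraph k r (r + 1) m"
    by (rule wf_digraph_digit_sum_digraph)
  show "arcs (digit_sum_digraph k r (r + 1) m) \<noteq> {}"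
    using tuples_of_sum_nonempty[OF assms] by (auto simp: arcs_digit_sum_digraph)
  \<comment> \<open>Arcs of weight \<open>r + 1\<close> are reduced to weight \<open>r\<close> by
    lowering a positive digit; both directions are needed, one for each end of the final
    walk.\<close>
  have lower: "\<exists>c \<in> tuples k (m + 1). sum_list c = r
      \<and> butlast a \<rightarrow>\<^sup>*\<^bsub>digit_sum_digraph k r (r + 1) m\<^esub> butlast c
      \<and> butlast c \<rightarrow>\<^sup>*\<^bsub>digit_sum_digraph k r (r + 1) m\<^esub> butlast a"
    if a: "a \<in> arcs (digit_sum_digraph k r (r + 1) m)" for a
  proof (cases "sum_list a = r")
    case True
    with reachable_rotate[OF a, of 0] a show ?thesis
      by (auto simp: arcs_digit_sum_digraph)
  next
    case False
    with a have sum: "sum_list a = r + 1" by (auto simp: arcs_digit_sum_digraph)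
    then obtain x where x: "x \<in> set a" "x > 0"
      by (metis add_is_0 gr0I one_neq_zero sum_list_eq_0_iff)
    then obtain i where i: "i < length a" "a ! i > 0"
      by (metis in_set_conv_nth)
    define c where "c = a[i := a ! i - 1]"
    have "a ! i - 1 < k"
      using a i by (auto simp: arcs_digit_sum_digraph tuples_def subset_iff less_imp_diff_less)
    then have c: "c \<in> tuples k (m + 1)"
      using a set_update_subset_insert[of a i "a ! i - 1"]
      by (auto simp: c_def arcs_digit_sum_digraph tuples_def)
    have csum: "sum_list c = r"
      using i sum by (simp add: c_def sum_list_update)
    have carc: "c \<in> arcs (digit_sum_digraph k r (r + 1) m)"
      using c csum by (simp add: arcs_digit_sum_digraph)
    \<comment> \<open>Writing \<open>a\<close> as an update of \<open>c\<close> lets the digit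
      change be applied in the reverse direction.\<close>
    have "a = c[i := a ! i]" by (simp add: c_def)
    then have "butlast c \<rightarrow>\<^sup>*\<^bsub>digit_sum_digraph k r (r + 1) m\<^esub> butlast a"
      using reachable_change_digit[OF carc] a by metis
    moreover have "butlast a \<rightarrow>\<^sup>*\<^bsub>digit_sum_digraph k r (r + 1) m\<^esub> butlast c"
      using reachable_change_digit[OF a] carc by (simp add: c_def)
    ultimately show ?thesis using c csum by blast
  qed
  fix a b
  assume "a \<in> arcs (digit_sum_digraph k r (r + 1) m)"
  then obtain c where c: "c \<in> tuples k (m + 1)" "sum_list c = r"
    and "butlast a \<rightarrow>\<^sup>*\<^bsub>digit_sum_digraph k r (r + 1) m\<^esub> butlast c"
    using lower by blast
  moreover assume "b \<in> arcs (digit_sum_digraph k r (r + 1) m)"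
  then obtain d where d: "d \<in> tuples k (m + 1)" "sum_list d = r"
    and "butlast d \<rightarrow>\<^sup>*\<^bsub>digit_sum_digraph k r (r + 1) m\<^esub> butlast b"
    using lower by blast
  ultimately show "butlast a \<rightarrow>\<^sup>*\<^bsub>digit_sum_digraph k r (r + 1) m\<^esub> butlast b"
    using reachable_consecutive_sums[OF c d] by (metis reachable_trans)
qed

section \<open>Single weight: the extreme values\<close>

text \<open>At most one digit is nonzero, and it can be rotated to the front. The resulting normal
  form depends only on the weight and the length.\<close>

lemma rotate_of_sum_le_1:
  fixes a :: "nat list"
  assumes "sum_list a \<le> 1" and "a \<noteq> []"
  shows "\<exists>i. rotate i a = sum_list a # replicate (length a - 1) 0"
proof (cases "sum_list a = 0")
  case True
  then have "a = replicate (length a) 0"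
    by (auto intro: replicate_eqI)
  with \<open>a \<noteq> []\<close> have "a = 0 # replicate (length a - 1) 0"
    by (cases a) auto
  then have "rotate 0 a = sum_list a # replicate (length a - 1) 0"
    using True by (metis rotate0 id_apply)
  then show ?thesis by blast
next
  case False
  then obtain x where "x \<in> set a" "x \<noteq> 0"
    by (metis sum_list_eq_0_iff)
  then obtain xs ys where split: "a = xs @ x # ys"
    by (metis split_list)
  with assms(1) have "sum_list xs + (x + sum_list ys) \<le> 1" by simp
  with \<open>x \<noteq> 0\<close> have "sum_list xs = 0" "sum_list ys = 0" by linarith+
  then have "ys @ xs = replicate (length a - 1) 0" "sum_list a = x"
    by (auto simp: split intro!: replicate_eqI)
  then have "rotate (length xs) a = sum_list a # replicate (length a - 1) 0"
    by (simp add: split rotate_append)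
  then show ?thesis by blast
qed

lemma sum_list_map_complement:
  fixes a :: "nat list"
  assumes "\<forall>x \<in> set a. x \<le> c"
  shows "sum_list (map (\<lambda>x. c - x) a) + sum_list a = c * length a"
  using assms by (induction a) auto

text \<open>Provides a normal form determined by \<open>r\<close>, \<open>k\<close> and
  \<open>m\<close> alone, so that any two tuples of the same extreme weight are rotations of each
  other. Weights near the maximum are reduced to weight at most 1 by replacing each digit
  \<open>x\<close> with \<open>k - 1 - x\<close>.\<close>

lemma rotate_of_extreme_sum:
  assumes a: "a \<in> tuples k (m + 1)"
    and r: "sum_list a = r" "r \<in> {0, 1, (k - 1) * (m + 1) - 1, (k - 1) * (m + 1)}"
  shows "\<exists>i. rotate i a = (if r \<le> 1 then r # replicate m 0
    else (k - 1 - ((k - 1) * (m + 1) - r)) # replicate m (k - 1))"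
proof (cases "r \<le> 1")
  case True
  moreover have "length a = m + 1" "a \<noteq> []" using a by (auto simp: tuples_def)
  ultimately show ?thesis using rotate_of_sum_le_1[of a] r(1) by simp
next
  case False
  define f where "f = (\<lambda>x. k - 1 - x)"
  have len: "length a = m + 1" and le: "\<forall>x \<in> set a. x \<le> k - 1"
    using a by (auto simp: tuples_def)
  have inv: "map f (map f a) = a"
    using le by (auto simp: f_def intro!: map_idI)
  have sum: "sum_list (map f a) = (k - 1) * (m + 1) - r"
    using sum_list_map_complement[OF le] len r(1) by (simp add: f_def)
  then have "sum_list (map f a) \<le> 1"
    using False r(2) by auto
  then obtain i where "rotate i (map f a) = ((k - 1) * (m + 1) - r) # replicate m 0"
    using rotate_of_sum_le_1[of "map f a"] len sum by (cases "a = []") auto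
  then have "map f (rotate i (map f a)) = (k - 1 - ((k - 1) * (m + 1) - r)) # replicate m (k - 1)"
    by (simp add: f_def map_replicate)
  \<comment> \<open>The digitwise complement commutes with rotation and is its own inverse on these
    digits, so the normal form carries over to \<open>a\<close>.\<close>
  with inv False show ?thesis
    by (metis rotate_map)
qed

lemma eulerian_extreme_sum:
  assumes r: "r \<in> {0, 1, (k - 1) * (m + 1) - 1, (k - 1) * (m + 1)}" and k: "k > 1"
  shows "eulerian (digit_sum_digraph k r r m)"
proof (rule eulerian_digit_sum_digraphI)
  interpret wf_digraph "digit_sum_digraph k r r m"
    by (rule wf_digraph_digit_sum_digraph)
  have "r \<le> (k - 1) * (m + 1)"
    using r k by auto
  then show "arcs (digit_sum_digraph k r r m) \<noteq> {}"
    using tuples_of_sum_nonempty[of r k "m + 1"] k by (auto simp: arcs_digit_sum_digraph)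
  fix a b
  assume a: "a \<in> arcs (digit_sum_digraph k r r m)" and b: "b \<in> arcs (digit_sum_digraph k r r m)"
  have "\<exists>i. rotate i c = (if r \<le> 1 then r # replicate m 0
      else (k - 1 - ((k - 1) * (m + 1) - r)) # replicate m (k - 1))"
    if "c \<in> arcs (digit_sum_digraph k r r m)" for c
    using that r by (intro rotate_of_extreme_sum) (auto simp: arcs_digit_sum_digraph)
  with a b obtain i j where "rotate i a = rotate j b"
    by metis
  then show "butlast a \<rightarrow>\<^sup>*\<^bsub>digit_sum_digraph k r r m\<^esub> butlast b"
    using reachable_rotate[OF a] reachable_rotate_back[OF b] by (metis reachable_trans)
qed

section \<open>Single weight: the digit multiset as an obstruction\<close>

text \<open>With the weight fixed at \<open>r\<close>, the digit missing from either end of an arc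
  is \<open>r\<close> minus the sum of that vertex. Hence both ends determine the same multiset,
  that of the arc.\<close>

lemma mset_arc:
  assumes "e \<in> arcs (digit_sum_digraph k r r m)"
  shows "add_mset (r - sum_list (butlast e)) (mset (butlast e)) = mset e"
    and "add_mset (r - sum_list (tl e)) (mset (tl e)) = mset e"
proof -
  have e: "e \<noteq> []" "sum_list e = r"
    using assms by (auto simp: arcs_digit_sum_digraph tuples_def)
  then show "add_mset (r - sum_list (tl e)) (mset (tl e)) = mset e"
    by (cases e) auto
  show "add_mset (r - sum_list (butlast e)) (mset (butlast e)) = mset e"
    using e by (cases e rule: rev_cases) auto
qed

lemma reachable_mset:
  assumes "u \<rightarrow>\<^sup>*\<^bsub>digit_sum_digraph k r r m\<^esub> v"
  shows "add_mset (r - sum_list u) (mset u) = add_mset (r - sum_list v) (mset v)"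
proof -
  interpret wf_digraph "digit_sum_digraph k r r m"
    by (rule wf_digraph_digit_sum_digraph)
  show ?thesis
    using assms
  proof (induction rule: reachable_induct)
    case (step x y)
    from step(2) obtain e where "e \<in> arcs (digit_sum_digraph k r r m)" "x = butlast e" "y = tl e"
      by (auto simp: arcs_ends_def arc_to_ends_def tail_digit_sum_digraph head_digit_sum_digraph)
    with step mset_arc show ?case by metis
  qed simp
qed

text \<open>Both tuples share a tail \<open>z\<close>; only the weight \<open>t\<close> of the first
  two positions is split differently, as \<open>x + (t - x)\<close> and as
  \<open>(x + 1) + (t - (x + 1))\<close>.\<close>

lemma ex_tuples_mset_neq:
  assumes n: "n \<ge> 2" and k: "k > 2" and r: "2 \<le> r" "r + 2 \<le> (k - 1) * n"
  shows "\<exists>a \<in> tuples k n. \<exists>b \<in> tuples k n. sum_list a = r \<and> sum_list b = r \<and> mset a \<noteq> mset b"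
proof -
  \<comment> \<open>The least \<open>t\<close> that is at least 2 and leaves a remainder fitting
    into \<open>n - 2\<close> positions. The bounds \<open>2 \<le> t\<close> and
    \<open>t + 2 \<le> 2 * (k - 1)\<close> leave room for two different splits.\<close>
  define t where "t = max 2 (r - (k - 1) * (n - 2))"
  obtain p where p: "n = p + 2" using n by (metis le_add_diff_inverse2)
  have "(k - 1) * n = (k - 1) * (n - 2) + 2 * (k - 1)"
    by (simp only: p) (simp add: add_mult_distrib2)
  then have "r + 2 \<le> (k - 1) * (n - 2) + 2 * (k - 1)" and "4 \<le> 2 * (k - 1)"
    using r(2) k by simp_all
  then have t: "2 \<le> t" "t + 2 \<le> 2 * (k - 1)" "t \<le> r" "r - t \<le> (k - 1) * (n - 2)"
    unfolding t_def using r(1) by linarith+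
  obtain z where z: "z \<in> tuples k (n - 2)" "sum_list z = r - t"
    using tuples_of_sum_nonempty[OF t(4)] k by auto
  \<comment> \<open>For small \<open>t\<close> the splits are \<open>0, t\<close> and
    \<open>1, t - 1\<close>. For larger \<open>t\<close> the first digit must be large to keep the
    second below \<open>k\<close>, so the first digits are \<open>k - 2\<close> and
    \<open>k - 1\<close>.\<close>
  define x where "x = (if t \<le> k - 1 then 0 else k - 2)"
  define a b where "a = x # (t - x) # z" and "b = (x + 1) # (t - (x + 1)) # z"
  have "a \<in> tuples k n" "b \<in> tuples k n"
    using z(1) t k n by (auto simp: a_def b_def x_def tuples_def)
  moreover have "sum_list a = r" "sum_list b = r"
    using z(2) t k by (auto simp: a_def b_def x_def)
  \<comment> \<open>Thus \<open>x\<close> is neither of the first two digits of \<open>b\<close>,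
    but it is the first digit of \<open>a\<close>; since \<open>z\<close> is common,
    \<open>x\<close> occurs more often in \<open>a\<close>.\<close>
  moreover have "t - (x + 1) \<noteq> x"
    using t(1,2) k by (auto simp: x_def)
  then have "count (mset a) x \<noteq> count (mset b) x"
    by (simp add: a_def b_def)
  then have "mset a \<noteq> mset b" by metis
  ultimately show ?thesis by blast
qed

text \<open>Strong connectivity would join the tails of two arcs with different digit multisets,
  contradicting the invariance of the multiset along walks.\<close>

lemma not_eulerian_middle_sum:
  assumes m: "m \<ge> 1" and k: "k > 2" and r: "2 \<le> r" "r + 2 \<le> (k - 1) * (m + 1)"
  shows "\<not> eulerian (digit_sum_digraph k r r m)"
proof
  assume "eulerian (digit_sum_digraph k r r m)"
  then have conn: "u \<rightarrow>\<^sup>*\<^bsub>digit_sum_digraph k r r m\<^esub> v"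
    if "u \<in> verts (digit_sum_digraph k r r m)" "v \<in> verts (digit_sum_digraph k r r m)" for u v
    using that by (auto simp: eulerian_def strongly_connected_def)
  interpret wf_digraph "digit_sum_digraph k r r m"
    by (rule wf_digraph_digit_sum_digraph)
  obtain a b where "a \<in> tuples k (m + 1)" "b \<in> tuples k (m + 1)" "sum_list a = r" "sum_list b = r"
    and neq: "mset a \<noteq> mset b"
    using ex_tuples_mset_neq[of "m + 1" k r] assms by auto
  then have ab: "a \<in> arcs (digit_sum_digraph k r r m)" "b \<in> arcs (digit_sum_digraph k r r m)"
    by (simp_all add: arcs_digit_sum_digraph)
  have "butlast a \<rightarrow>\<^sup>*\<^bsub>digit_sum_digraph k r r m\<^esub> butlast b"
    using ab[THEN tail_in_verts] by (intro conn) (simp_all add: tail_digit_sum_digraph)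
  with neq show False
    using reachable_mset mset_arc(1) ab by metis
qed

theorem theorem4p5:
  fixes n k :: nat
  assumes "n \<ge> 2" and "k > 2"
  shows "(\<forall>r::nat. r \<le> (k - 1) * n \<longrightarrow>
            (eulerian (digit_sum_digraph k r r (n - 1)) \<longleftrightarrow>
              r \<in> {0, 1, (k - 1) * n - 1, (k - 1) * n}))
       \<and> (\<forall>r::nat. r < (k - 1) * n \<longrightarrow>
            eulerian (digit_sum_digraph k r (r + 1) (n - 1)))"
proof (intro conjI allI impI)
  have n: "n - 1 + 1 = n" "n - 1 \<ge> 1" using assms by auto
  {
    fix r assume r: "r \<le> (k - 1) * n"
    show "eulerian (digit_sum_digraph k r r (n - 1)) \<longleftrightarrow>
        r \<in> {0, 1, (k - 1) * n - 1, (k - 1) * n}"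
    proof (cases "r \<in> {0, 1, (k - 1) * n - 1, (k - 1) * n}")
      case True
      with eulerian_extreme_sum[of r k "n - 1"] assms(2) n show ?thesis by simp
    next
      case False
      with r have "2 \<le> r" "r + 2 \<le> (k - 1) * n" by auto
      with not_eulerian_middle_sum[of "n - 1" k r] assms(2) n False show ?thesis by simp
    qed
  next
    fix r assume "r < (k - 1) * n"
    then show "eulerian (digit_sum_digraph k r (r + 1) (n - 1))"
      using eulerian_consecutive_sums[of r k "n - 1"] assms(2) n by simp
  }
qed

end
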